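(* Let $2<\alpha\le 3$, $\eta\in(0,1)$, $\mu\ge 0$, $\beta\ge 0$, and let $A:[0,1]\to\mathbb{R}$ be a function of bounded variation. Put $\Lambda=\mu\eta+\beta\int_0^1 t\,dA(t)$, and assume $0\le\Lambda<1$ and $g_A(s)\ge 0$ for all $s\in[0,1]$, where $g_A$ is defined in the context. For $a>0$ let $\mathcal{K}_a=a\mathcal{K}$ be the linear operator on $E=C([0,1],\mathbb{R})$ with $$(\mathcal{K}u)(t)=\int_0^1\mathcal{H}(t,s)u(s)\,ds,$$ where $\mathcal{H}$ is defined in the context. Then the spectral radius of $\mathcal{K}_a$ satisfies $$a\tau_1\le r(\mathcal{K}_a)\le a\tau_2,$$ where $$\tau_1=\frac{\eta-\eta^{\alpha-1}}{1-\Lambda}\int_0^1 (s-s^{\alpha-1})\Big(\beta g_A(s)+(\mu-\Lambda+1)\Psi(s)\Big)ds,\qquad \tau_2=\frac{1}{1-\Lambda}\Big(\beta\int_0^1 g_A(s)\,ds+\frac{\mu-\Lambda+1}{\Gamma(\alpha+1)}\Big),$$ and $\Psi(s)=\frac{(1-s)^{\alpha-1}}{\Gamma(\alpha)}$.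
   Context: Integrals against $dA$ are Riemann–Stieltjes integrals. $E=C([0,1],\mathbb{R})$ carries the sup norm, and the spectral radius of a bounded linear operator $L$ on $E$ is $r(L)=\lim_{n\to\infty}\|L^n\|^{1/n}$ (Gelfand's formula). Define $$\mathcal{G}(t,s)=\frac{1}{\Gamma(\alpha)}\begin{cases} t(1-s)^{\alpha-1}-(t-s)^{\alpha-1}, & 0\le s\le t\le 1,\\ t(1-s)^{\alpha-1}, & 0\le t\le s\le 1,\end{cases}\qquad g_A(s)=\int_0^1\mathcal{G}(t,s)\,dA(t),$$ $$\mathcal{H}(t,s)=\frac{\beta t}{1-\Lambda}\,g_A(s)+\frac{\mu t}{1-\Lambda}\,\mathcal{G}(\eta,s)+\mathcal{G}(t,s),\qquad t,s\in[0,1].$$ *)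

theory Defs
  imports "HOL-Analysis.Analysis"
begin

section \<open>Functions of bounded variation and the Riemann--Stieltjes integral\<close>

text \<open>In both definitions the members \<open>k\<close> of a division are compact intervals
  \<open>{Inf k..Sup k}\<close>. A degenerate one contributes \<open>0\<close>.\<close>

definition bounded_variation_on :: "(real \<Rightarrow> real) \<Rightarrow> real \<Rightarrow> real \<Rightarrow> bool" where
  "bounded_variation_on A a b \<longleftrightarrow>
     (\<exists>M. \<forall>d. d division_of {a..b} \<longrightarrow> (\<Sum>k\<in>d. \<bar>A (Sup k) - A (Inf k)\<bar>) \<le> M)"

text \<open>The limit is taken as the mesh of the tagged division tends to \<open>0\<close>.\<close>

definition has_rs_integral :: "(real \<Rightarrow> real) \<Rightarrow> (real \<Rightarrow> real) \<Rightarrow> real \<Rightarrow> real \<Rightarrow> real \<Rightarrow> bool" where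
  "has_rs_integral f A a b I \<longleftrightarrow>
     (\<forall>\<epsilon>>0. \<exists>\<delta>>0. \<forall>p. p tagged_division_of {a..b} \<and> (\<forall>(x, k)\<in>p. Sup k - Inf k < \<delta>) \<longrightarrow>
        \<bar>(\<Sum>(x, k)\<in>p. f x * (A (Sup k) - A (Inf k))) - I\<bar> < \<epsilon>)"

definition rs_integral :: "(real \<Rightarrow> real) \<Rightarrow> (real \<Rightarrow> real) \<Rightarrow> real \<Rightarrow> real \<Rightarrow> real" where
  "rs_integral f A a b = (THE I. has_rs_integral f A a b I)"

lemma small_mesh_exists:
  fixes a b :: real
  assumes "0 < \<delta>"
  obtains p where "p tagged_division_of {a..b}" "\<forall>(x, k)\<in>p. Sup k - Inf k < \<delta>"
proof -
  have "gauge (\<lambda>x::real. ball x (\<delta> / 2))"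
    using assms by (intro gauge_ball) auto
  then obtain p where p: "p tagged_division_of {a..b}" "(\<lambda>x. ball x (\<delta> / 2)) fine p"
    using fine_division_exists_real by blast
  have "Sup k - Inf k < \<delta>" if xk: "(x, k) \<in> p" for x k
  proof -
    obtain c d where k: "k = {c..d}" and "x \<in> k"
      using tagged_division_ofD(4)[OF p(1) xk] tagged_division_ofD(2)[OF p(1) xk] by auto
    then have cd: "c \<le> d" by auto
    have "k \<subseteq> ball x (\<delta> / 2)" using p(2) xk by (auto simp: fine_def)
    then have "c \<in> ball x (\<delta> / 2)" "d \<in> ball x (\<delta> / 2)" using k cd by auto
    then have "\<bar>x - c\<bar> < \<delta> / 2" "\<bar>x - d\<bar> < \<delta> / 2" by (auto simp: dist_real_def)
    then have "d - c < \<delta>" by (simp add: abs_if field_simps split: if_splits)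
    then show ?thesis using k cd by simp
  qed
  then have "\<forall>(x, k)\<in>p. Sup k - Inf k < \<delta>" by blast
  with p(1) show ?thesis by (rule that)
qed

lemma has_rs_integral_unique:
  assumes "has_rs_integral f A a b I" "has_rs_integral f A a b J"
  shows "I = J"
proof (rule ccontr)
  assume "I \<noteq> J"
  then have e: "\<bar>I - J\<bar> / 2 > 0" by simp
  let ?S = "\<lambda>p. \<Sum>(x, k)\<in>p. f x * (A (Sup k) - A (Inf k))"
  obtain \<delta>1 where 1: "\<delta>1 > 0"
    "\<And>p. p tagged_division_of {a..b} \<Longrightarrow> \<forall>(x, k)\<in>p. Sup k - Inf k < \<delta>1 \<Longrightarrow> \<bar>?S p - I\<bar> < \<bar>I - J\<bar> / 2"
    using assms(1) e unfolding has_rs_integral_def by meson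
  obtain \<delta>2 where 2: "\<delta>2 > 0"
    "\<And>p. p tagged_division_of {a..b} \<Longrightarrow> \<forall>(x, k)\<in>p. Sup k - Inf k < \<delta>2 \<Longrightarrow> \<bar>?S p - J\<bar> < \<bar>I - J\<bar> / 2"
    using assms(2) e unfolding has_rs_integral_def by meson
  obtain p where p: "p tagged_division_of {a..b}" "\<forall>(x, k)\<in>p. Sup k - Inf k < min \<delta>1 \<delta>2"
    using small_mesh_exists[of "min \<delta>1 \<delta>2"] 1(1) 2(1) by auto
  have "\<bar>?S p - I\<bar> < \<bar>I - J\<bar> / 2" "\<bar>?S p - J\<bar> < \<bar>I - J\<bar> / 2"
    using 1(2)[OF p(1)] 2(2)[OF p(1)] p(2) by fastforce+
  moreover have "\<bar>I - J\<bar> \<le> \<bar>?S p - I\<bar> + \<bar>?S p - J\<bar>" by (simp add: abs_if)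
  ultimately show False by simp
qed

lemma rs_integral_unique: "has_rs_integral f A a b I \<Longrightarrow> rs_integral f A a b = I"
  unfolding rs_integral_def by (blast intro: has_rs_integral_unique)

section \<open>The Banach space of continuous functions on the unit interval\<close>

text \<open>The interval is made a metric space type, so that \<open>C([0,1],\<real>)\<close> with the sup norm is
  the library type of bounded continuous functions on it.\<close>

typedef unit_ivl = "{0..1::real}"
  morphisms ivl_val to_ivl
  by (rule exI[of _ 0]) simp

instantiation unit_ivl :: metric_space
begin

definition dist_unit_ivl :: "unit_ivl \<Rightarrow> unit_ivl \<Rightarrow> real" where
  "dist_unit_ivl x y = dist (ivl_val x) (ivl_val y)"

definition uniformity_unit_ivl :: "(unit_ivl \<times> unit_ivl) filter" where
  "uniformity_unit_ivl = (INF e\<in>{0 <..}. principal {(x, y). dist x y < e})"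

definition open_unit_ivl :: "unit_ivl set \<Rightarrow> bool" where
  "open_unit_ivl S = (\<forall>x\<in>S. \<forall>\<^sub>F (x', y) in uniformity. x' = x \<longrightarrow> y \<in> S)"

instance
proof
  fix x y z :: unit_ivl
  show "dist x y = 0 \<longleftrightarrow> x = y"
    by (simp add: dist_unit_ivl_def ivl_val_inject)
  show "dist x y \<le> dist x z + dist y z"
    unfolding dist_unit_ivl_def by (rule dist_triangle2)
qed (simp_all add: uniformity_unit_ivl_def open_unit_ivl_def)

end

type_synonym C01 = "unit_ivl \<Rightarrow>\<^sub>C real"

definition spectral_radius :: "('a::real_normed_vector \<Rightarrow> 'a) \<Rightarrow> real" where
  "spectral_radius L = lim (\<lambda>n. root n (onorm (L ^^ n)))"

section \<open>Kernels and the integral operator\<close>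

definition G :: "real \<Rightarrow> real \<Rightarrow> real \<Rightarrow> real" where
  "G \<alpha> t s = 1 / Gamma \<alpha> *
     (if s \<le> t then t * (1 - s) powr (\<alpha> - 1) - (t - s) powr (\<alpha> - 1)
      else t * (1 - s) powr (\<alpha> - 1))"

definition gA :: "real \<Rightarrow> (real \<Rightarrow> real) \<Rightarrow> real \<Rightarrow> real" where
  "gA \<alpha> A s = rs_integral (\<lambda>t. G \<alpha> t s) A 0 1"

definition Lam :: "real \<Rightarrow> real \<Rightarrow> real \<Rightarrow> (real \<Rightarrow> real) \<Rightarrow> real" where
  "Lam \<eta> \<mu> \<beta> A = \<mu> * \<eta> + \<beta> * rs_integral (\<lambda>t. t) A 0 1"

definition H :: "real \<Rightarrow> real \<Rightarrow> real \<Rightarrow> real \<Rightarrow> (real \<Rightarrow> real) \<Rightarrow> real \<Rightarrow> real \<Rightarrow> real" where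
  "H \<alpha> \<eta> \<mu> \<beta> A t s =
     \<beta> * t / (1 - Lam \<eta> \<mu> \<beta> A) * gA \<alpha> A s
     + \<mu> * t / (1 - Lam \<eta> \<mu> \<beta> A) * G \<alpha> \<eta> s + G \<alpha> t s"

definition \<Psi> :: "real \<Rightarrow> real \<Rightarrow> real" where
  "\<Psi> \<alpha> s = (1 - s) powr (\<alpha> - 1) / Gamma \<alpha>"

definition K_fun :: "real \<Rightarrow> real \<Rightarrow> real \<Rightarrow> real \<Rightarrow> (real \<Rightarrow> real) \<Rightarrow> C01 \<Rightarrow> unit_ivl \<Rightarrow> real" where
  "K_fun \<alpha> \<eta> \<mu> \<beta> A u t =
     integral {0..1} (\<lambda>s. H \<alpha> \<eta> \<mu> \<beta> A (ivl_val t) s * apply_bcontfun u (to_ivl s))"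

text \<open>\<^const>\<open>Bcontfun\<close> is meaningful only on continuous functions. That \<^const>\<open>K_fun\<close> maps
  continuous functions to continuous ones is not part of the definition and has to be proved.\<close>

definition K_op :: "real \<Rightarrow> real \<Rightarrow> real \<Rightarrow> real \<Rightarrow> (real \<Rightarrow> real) \<Rightarrow> C01 \<Rightarrow> C01" where
  "K_op \<alpha> \<eta> \<mu> \<beta> A u = Bcontfun (K_fun \<alpha> \<eta> \<mu> \<beta> A u)"

definition Ka_op :: "real \<Rightarrow> real \<Rightarrow> real \<Rightarrow> real \<Rightarrow> (real \<Rightarrow> real) \<Rightarrow> real \<Rightarrow> C01 \<Rightarrow> C01" where
  "Ka_op \<alpha> \<eta> \<mu> \<beta> A a u = a *\<^sub>R K_op \<alpha> \<eta> \<mu> \<beta> A u"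

definition \<tau>1 :: "real \<Rightarrow> real \<Rightarrow> real \<Rightarrow> real \<Rightarrow> (real \<Rightarrow> real) \<Rightarrow> real" where
  "\<tau>1 \<alpha> \<eta> \<mu> \<beta> A =
     (\<eta> - \<eta> powr (\<alpha> - 1)) / (1 - Lam \<eta> \<mu> \<beta> A) *
     integral {0..1} (\<lambda>s. (s - s powr (\<alpha> - 1)) *
       (\<beta> * gA \<alpha> A s + (\<mu> - Lam \<eta> \<mu> \<beta> A + 1) * \<Psi> \<alpha> s))"

definition \<tau>2 :: "real \<Rightarrow> real \<Rightarrow> real \<Rightarrow> real \<Rightarrow> (real \<Rightarrow> real) \<Rightarrow> real" where
  "\<tau>2 \<alpha> \<eta> \<mu> \<beta> A =
     1 / (1 - Lam \<eta> \<mu> \<beta> A) *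
     (\<beta> * integral {0..1} (gA \<alpha> A) + (\<mu> - Lam \<eta> \<mu> \<beta> A + 1) / Gamma (\<alpha> + 1))"

end

theory Submission
  imports Defs
begin

text \<open>
  The kernel \<^term>\<open>H\<close> is squeezed between two separated kernels. Put \<open>c t = t - t\<^sup>\<alpha>\<^sup>-\<^sup>1\<close> and
  let \<open>\<Phi>\<close> be the function \<open>majorant\<close> below, whose integral is \<^term>\<open>\<tau>2\<close>. Then
  \<open>c t * c \<eta> * \<Phi> s \<le> H t s \<le> \<Phi> s\<close> on the unit square (\<open>H_ge_majorant\<close>, \<open>H_le_majorant\<close>).
  Both bounds come from \<open>c t * \<Psi> s \<le> G t s \<le> t * \<Psi> s\<close>. The right inequality drops the
  subtracted term of \<open>G\<close>; the left one bounds it by means of \<open>t - s \<le> t * (1 - s)\<close>.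

  The factor \<open>a\<close> only rescales the kernel, so let \<open>a = 1\<close> and write \<open>K\<close> for the operator. As \<open>H\<close>
  is nonnegative, its upper bound gives \<open>norm (K u) \<le> \<tau>2 * norm u\<close>, hence the spectral radius is
  at most \<^term>\<open>\<tau>2\<close>. The lower bound on \<open>H\<close>, integrated
  against \<open>c\<close> itself, gives \<open>K c \<ge> \<tau>1 * c\<close> pointwise. A positive operator preserves such an
  inequality under iteration, so \<open>K\<^sup>n c \<ge> \<tau>1\<^sup>n * c\<close>. As \<open>c\<close> is positive somewhere, the
  norms of the powers grow at least like \<open>\<tau>1\<^sup>n\<close> (\<open>spectral_radius_ge_of_subeigenvector\<close>).
  The limit in Gelfand's formula exists because the norms of the powers are submultiplicative.

  All of this needs the kernel to be continuous, so that \<open>K\<close> is a bounded operator on \<open>C([0,1])\<close>.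
  The only nontrivial summand is \<^term>\<open>gA\<close>, a Riemann--Stieltjes integral that depends on a
  parameter. An integrator of bounded variation is a difference of monotone functions, and for a
  monotone integrator the integral exists by a change of variables to an ordinary integral
  (\<open>has_rs_integral_mono_exists\<close>). Once the integral exists, its continuity in the parameter
  follows from the bound of the integral by the sup norm times the variation.
\<close>

section \<open>Gelfand's limit\<close>

lemma submultiplicative_power_le:
  fixes b :: "nat \<Rightarrow> real"
  assumes nonneg: "\<And>n. 0 \<le> b n" and sub: "\<And>m n. b (m + n) \<le> b m * b n"
  shows "b (q * m + r) \<le> b m ^ q * b r"
proof (induction q)
  case (Suc q)
  have "b (Suc q * m + r) = b (m + (q * m + r))" by (simp add: add.assoc)
  also have "\<dots> \<le> b m * b (q * m + r)" by (rule sub)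
  also have "\<dots> \<le> b m * (b m ^ q * b r)" by (intro mult_left_mono Suc.IH nonneg)
  finally show ?case by (simp add: mult_ac)
qed simp

text \<open>Fekete's argument. The limit is the infimum \<open>L\<close> of the roots: if \<open>root m (b m) < x\<close> for a
  single \<open>m\<close>, then division of \<open>n\<close> by \<open>m\<close> with remainder gives \<open>b n \<le> C * x ^ n\<close> for all \<open>n\<close>, and
  the \<open>n\<close>-th root of the constant tends to 1.\<close>

lemma submultiplicative_root_convergent:
  fixes b :: "nat \<Rightarrow> real"
  assumes nonneg: "\<And>n. 0 \<le> b n" and sub: "\<And>m n. b (m + n) \<le> b m * b n"
  shows "convergent (\<lambda>n. root n (b n))"
proof -
  define L where "L = (INF n\<in>{1..}. root n (b n))"
  have bdd: "bdd_below ((\<lambda>n. root n (b n)) ` {1..})"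
    by (rule bdd_belowI[where m = 0]) (auto intro: real_root_ge_zero nonneg)
  have L_le: "L \<le> root n (b n)" if "n \<ge> 1" for n
    unfolding L_def using that by (intro cINF_lower bdd) auto
  have L0: "0 \<le> L"
    unfolding L_def by (rule cINF_greatest) (auto intro: real_root_ge_zero nonneg)
  have "(\<lambda>n. root n (b n)) \<longlonglongrightarrow> L"
  proof (rule order_tendstoI)
    fix y assume "y < L"
    then show "\<forall>\<^sub>F n in sequentially. y < root n (b n)"
      using L_le by (intro eventually_sequentiallyI[of 1]) (metis less_le_trans)
  next
    fix y assume y: "L < y"
    define x where "x = (L + y) / 2"
    have x: "0 < x" "L < x" "x < y" using y L0 by (auto simp: x_def)
    obtain m where m: "m \<ge> 1" "root m (b m) < x"
    proof -
      have "\<exists>n\<in>{1::nat..}. root n (b n) < x"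
        using x(2) bdd unfolding L_def by (subst (asm) cINF_less_iff) auto
      then show ?thesis using that by auto
    qed
    have bm: "b m \<le> x ^ m"
    proof -
      have "b m = root m (b m) ^ m" using m nonneg by simp
      also have "\<dots> \<le> x ^ m" using m nonneg by (intro power_mono real_root_ge_zero) auto
      finally show ?thesis .
    qed
    \<comment> \<open>The summand 1 only makes the constant positive.\<close>
    define C where "C = 1 + (\<Sum>r<m. b r / x ^ r)"
    have C: "C > 0" unfolding C_def using x nonneg by (intro add_pos_nonneg sum_nonneg) auto
    have bC: "b r \<le> C * x ^ r" if "r < m" for r
    proof -
      have "b r / x ^ r \<le> (\<Sum>r<m. b r / x ^ r)"
        using that x nonneg by (intro member_le_sum) auto
      then have "b r / x ^ r \<le> C" by (simp add: C_def)
      then show ?thesis using x by (simp add: field_simps)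
    qed
    have le: "b n \<le> C * x ^ n" for n
    proof -
      have "b n = b (n div m * m + n mod m)" by simp
      also have "\<dots> \<le> b m ^ (n div m) * b (n mod m)"
        by (rule submultiplicative_power_le[OF nonneg sub])
      also have "\<dots> \<le> (x ^ m) ^ (n div m) * (C * x ^ (n mod m))"
        using m x by (intro mult_mono power_mono bm bC nonneg zero_le_power) auto
      also have "\<dots> = C * x ^ (m * (n div m) + n mod m)"
        by (simp only: power_add power_mult mult_ac)
      finally show ?thesis by simp
    qed
    have root_le: "root n (b n) \<le> root n C * x" if "n \<ge> 1" for n
    proof -
      have "root n (b n) \<le> root n (C * x ^ n)" using le that by simp
      also have "\<dots> = root n C * x"
        using that x by (simp add: real_root_mult real_root_power_cancel)
      finally show ?thesis .
    qed
    have "\<forall>\<^sub>F n in sequentially. root n C * x < y"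
    proof (rule order_tendstoD(2))
      show "(\<lambda>n. root n C * x) \<longlonglongrightarrow> 1 * x" by (intro tendsto_intros LIMSEQ_root_const C)
    qed (use x in auto)
    with eventually_ge_at_top[of 1] show "\<forall>\<^sub>F n in sequentially. root n (b n) < y"
      by eventually_elim (rule le_less_trans[OF root_le])
  qed
  then show ?thesis by (auto simp: convergent_def)
qed

lemma bounded_linear_funpow:
  fixes L :: "'a::real_normed_vector \<Rightarrow> 'a"
  shows "bounded_linear L \<Longrightarrow> bounded_linear (L ^^ n)"
proof (induction n)
  case (Suc n)
  then show ?case using bounded_linear_compose[of L "L ^^ n"] by (simp add: comp_def)
qed (simp add: id_def bounded_linear_ident)

lemma gelfand_convergent:
  fixes L :: "'a::real_normed_vector \<Rightarrow> 'a"
  assumes "bounded_linear L"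
  shows "convergent (\<lambda>n. root n (onorm (L ^^ n)))"
  using onorm_compose[OF bounded_linear_funpow[OF assms] bounded_linear_funpow[OF assms]]
  by (intro submultiplicative_root_convergent)
    (simp_all add: funpow_add onorm_pos_le bounded_linear_funpow assms)

lemma gelfand_tendsto:
  assumes "bounded_linear L"
  shows "(\<lambda>n. root n (onorm (L ^^ n))) \<longlonglongrightarrow> spectral_radius L"
  using gelfand_convergent[OF assms] by (simp add: convergent_LIMSEQ_iff spectral_radius_def)

lemma spectral_radius_le:
  assumes L: "bounded_linear L" and c: "0 \<le> c" and le: "\<And>u. norm (L u) \<le> c * norm u"
  shows "spectral_radius L \<le> c"
proof (rule LIMSEQ_le_const2[OF gelfand_tendsto[OF L]], intro exI[of _ 1] allI impI)
  fix n :: nat assume n: "1 \<le> n"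
  have "norm ((L ^^ n) u) \<le> c ^ n * norm u" for u
  proof (induction n)
    case (Suc n)
    have "norm ((L ^^ Suc n) u) \<le> c * norm ((L ^^ n) u)" using le by simp
    also have "\<dots> \<le> c * (c ^ n * norm u)" by (intro mult_left_mono Suc.IH c)
    finally show ?case by (simp add: mult_ac)
  qed simp
  then have "onorm (L ^^ n) \<le> c ^ n" using c by (intro onorm_bound) auto
  then have "root n (onorm (L ^^ n)) \<le> root n (c ^ n)" using n by simp
  also have "\<dots> = c" using n c by (simp add: real_root_power_cancel)
  finally show "root n (onorm (L ^^ n)) \<le> c" .
qed

text \<open>The lower half of a Collatz--Wielandt estimate. Positivity applied to
  \<open>L\<^sup>n v - l\<^sup>n v \<ge> 0\<close> turns \<open>L v \<ge> l v\<close> into \<open>L\<^sup>n v \<ge> l\<^sup>n v\<close> for every \<open>n\<close>.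
  Evaluation at a point where \<open>v\<close> is positive bounds the operator norm of \<open>L\<^sup>n\<close> below by a
  fixed positive multiple of \<open>l\<^sup>n\<close>, and the multiple disappears in the \<open>n\<close>-th root.\<close>

lemma spectral_radius_ge_of_subeigenvector:
  fixes L :: "('a::topological_space \<Rightarrow>\<^sub>C real) \<Rightarrow> ('a \<Rightarrow>\<^sub>C real)"
  assumes L: "bounded_linear L"
    and pos: "\<And>u x. (\<And>y. 0 \<le> apply_bcontfun u y) \<Longrightarrow> 0 \<le> apply_bcontfun (L u) x"
    and l: "0 \<le> l"
    and sub: "\<And>x. l * apply_bcontfun v x \<le> apply_bcontfun (L v) x"
    and x0: "0 < apply_bcontfun v x0"
  shows "l \<le> spectral_radius L"
proof -
  interpret L: bounded_linear L by (rule L)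
  have iter: "l ^ n * apply_bcontfun v x \<le> apply_bcontfun ((L ^^ n) v) x" for n x
  proof (induction n arbitrary: x)
    case (Suc n)
    have "0 \<le> apply_bcontfun (L ((L ^^ n) v - l ^ n *\<^sub>R v)) x"
      by (rule pos) (use Suc.IH in simp)
    then have "l ^ n * apply_bcontfun (L v) x \<le> apply_bcontfun ((L ^^ Suc n) v) x"
      by (simp add: L.diff L.scaleR)
    moreover have "l ^ n * (l * apply_bcontfun v x) \<le> l ^ n * apply_bcontfun (L v) x"
      by (intro mult_left_mono sub) (simp add: l)
    ultimately show ?case by (simp add: mult_ac)
  qed simp
  define \<kappa> where "\<kappa> = apply_bcontfun v x0 / norm v"
  have "0 < norm v" using x0 norm_bounded[of v x0] unfolding real_norm_def by linarith
  then have \<kappa>: "0 < \<kappa>" using x0 by (simp add: \<kappa>_def)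
  have "root n \<kappa> * l \<le> root n (onorm (L ^^ n))" if n: "n \<ge> 1" for n
  proof -
    have "l ^ n * apply_bcontfun v x0 \<le> norm ((L ^^ n) v)"
      using iter[of n x0] norm_bounded[of "(L ^^ n) v" x0] by simp
    also have "\<dots> \<le> onorm (L ^^ n) * norm v"
      by (rule onorm[OF bounded_linear_funpow[OF L]])
    finally have "\<kappa> * l ^ n \<le> onorm (L ^^ n)"
      using \<open>0 < norm v\<close> by (simp add: \<kappa>_def field_simps)
    then have "root n (\<kappa> * l ^ n) \<le> root n (onorm (L ^^ n))" using n by simp
    then show ?thesis using n l by (simp add: real_root_mult real_root_power_cancel)
  qed
  moreover have "(\<lambda>n. root n \<kappa> * l) \<longlonglongrightarrow> 1 * l"
    by (intro tendsto_intros LIMSEQ_root_const \<kappa>)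
  ultimately show ?thesis
    using LIMSEQ_le[OF _ gelfand_tendsto[OF L], of "\<lambda>n. root n \<kappa> * l" l] by auto
qed

section \<open>Integral operators on C([0,1])\<close>

definition kernel_fun :: "(real \<Rightarrow> real \<Rightarrow> real) \<Rightarrow> C01 \<Rightarrow> unit_ivl \<Rightarrow> real" where
  "kernel_fun k u t =
     integral {0..1} (\<lambda>s. k (ivl_val t) s * apply_bcontfun u (to_ivl s))"

definition kernel_op :: "(real \<Rightarrow> real \<Rightarrow> real) \<Rightarrow> C01 \<Rightarrow> C01" where
  "kernel_op k u = Bcontfun (kernel_fun k u)"

lemma ivl_val_bounds: "0 \<le> ivl_val x" "ivl_val x \<le> 1"
  using ivl_val[of x] by auto

lemma continuous_on_ivl_val: "continuous_on S ivl_val"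
  unfolding continuous_on_iff by (metis dist_unit_ivl_def)

lemma continuous_on_to_ivl: "continuous_on {0..1} to_ivl"
  unfolding continuous_on_iff by (auto simp: dist_unit_ivl_def to_ivl_inverse)

lemma continuous_on_apply_to_ivl: "continuous_on {0..1} (\<lambda>s. apply_bcontfun u (to_ivl s))"
  by (rule continuous_on_compose2[OF continuous_on_apply_bcontfun[of UNIV] continuous_on_to_ivl]) simp

lemma bcontfun_of_continuous_on:
  assumes "continuous_on {0..1} f"
  shows "(\<lambda>x. f (ivl_val x)) \<in> bcontfun"
proof -
  have "bounded (f ` {0..1})"
    by (intro compact_imp_bounded compact_continuous_image assms) simp
  then have "bounded (range (\<lambda>x. f (ivl_val x)))"
    by (rule bounded_subset) (auto simp: ivl_val_bounds)
  moreover have "continuous_on UNIV (\<lambda>x. f (ivl_val x))"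
    by (rule continuous_on_compose2[OF assms continuous_on_ivl_val]) (auto simp: ivl_val_bounds)
  ultimately show ?thesis by (simp add: bcontfun_def)
qed

context
  fixes k :: "real \<Rightarrow> real \<Rightarrow> real"
  assumes k: "continuous_on ({0..1} \<times> {0..1}) (\<lambda>(t, s). k t s)"
begin

lemma kernel_integrable:
  assumes "t \<in> {0..1}"
  shows "(\<lambda>s. k t s * apply_bcontfun u (to_ivl s)) integrable_on {0..1}"
proof (intro integrable_continuous_real continuous_on_mult continuous_on_apply_to_ivl)
  show "continuous_on {0..1} (k t)"
    using continuous_on_compose2[OF k, of "{0..1}" "\<lambda>s. (t, s)"] assms
    by (force intro: continuous_intros)
qed

lemma apply_kernel_op: "apply_bcontfun (kernel_op k u) t = kernel_fun k u t"
proof -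
  have "continuous_on ({0..1} \<times> {0..1}) (\<lambda>p. apply_bcontfun u (to_ivl (snd p)))"
    by (rule continuous_on_compose2[OF continuous_on_apply_to_ivl]) (auto intro: continuous_intros)
  then have "continuous_on ({0..1} \<times> cbox 0 1) (\<lambda>(t, s). k t s * apply_bcontfun u (to_ivl s))"
    using continuous_on_mult[OF k] by (simp add: case_prod_unfold)
  then have "continuous_on {0..1} (\<lambda>t. integral (cbox 0 1) (\<lambda>s. k t s * apply_bcontfun u (to_ivl s)))"
    by (rule integral_continuous_on_param)
  then have "kernel_fun k u \<in> bcontfun"
    using bcontfun_of_continuous_on unfolding kernel_fun_def by simp
  then show ?thesis unfolding kernel_op_def by (simp add: Bcontfun_inverse)
qed

lemma norm_kernel_op_le:
  assumes bd: "\<And>t s. t \<in> {0..1} \<Longrightarrow> s \<in> {0..1} \<Longrightarrow> \<bar>k t s\<bar> \<le> \<Phi> s"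
    and \<Phi>: "\<Phi> integrable_on {0..1}"
  shows "norm (kernel_op k u) \<le> integral {0..1} \<Phi> * norm u"
proof (rule norm_bound)
  fix t
  have "norm (kernel_fun k u t) \<le> integral {0..1} (\<lambda>s. \<Phi> s * norm u)"
    unfolding kernel_fun_def
  proof (rule integral_norm_bound_integral)
    fix s :: real assume "s \<in> {0..1}"
    then have "\<bar>k (ivl_val t) s\<bar> \<le> \<Phi> s" using bd ivl_val_bounds by simp
    then show "norm (k (ivl_val t) s * apply_bcontfun u (to_ivl s)) \<le> \<Phi> s * norm u"
      using norm_bounded[of u "to_ivl s"] by (auto simp: abs_mult intro!: mult_mono)
  qed (auto intro!: kernel_integrable integrable_on_mult_left \<Phi> simp: ivl_val_bounds)
  then show "norm (apply_bcontfun (kernel_op k u) t) \<le> integral {0..1} \<Phi> * norm u"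
    by (simp add: apply_kernel_op)
qed

lemma bounded_linear_kernel_op: "bounded_linear (kernel_op k)"
proof -
  have "bounded ((\<lambda>(t, s). k t s) ` ({0..1} \<times> {0..1}))"
    by (intro compact_imp_bounded compact_continuous_image k compact_Times) simp_all
  then obtain C where C: "\<And>t s. t \<in> {0..1} \<Longrightarrow> s \<in> {0..1} \<Longrightarrow> \<bar>k t s\<bar> \<le> C"
    unfolding bounded_iff by fastforce
  show ?thesis
  proof (rule bounded_linear_intro[where K = C])
    fix u v :: C01 and r :: real
    note int = kernel_integrable[of "ivl_val _"]
    show "kernel_op k (u + v) = kernel_op k u + kernel_op k v"
      by (rule bcontfun_eqI)
        (simp add: apply_kernel_op kernel_fun_def ring_distribs integral_add int ivl_val_bounds)
    show "kernel_op k (r *\<^sub>R u) = r *\<^sub>R kernel_op k u"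
      by (rule bcontfun_eqI)
        (simp add: apply_kernel_op kernel_fun_def mult.left_commute[of _ r])
    show "norm (kernel_op k u) \<le> norm u * C"
      using norm_kernel_op_le[of "\<lambda>_. C" u] C integrable_on_const[of "{0..1::real}" C]
      by (simp add: mult.commute)
  qed
qed

lemma spectral_radius_kernel_op_le:
  assumes bd: "\<And>t s. t \<in> {0..1} \<Longrightarrow> s \<in> {0..1} \<Longrightarrow> \<bar>k t s\<bar> \<le> \<Phi> s"
    and \<Phi>: "\<Phi> integrable_on {0..1}"
  shows "spectral_radius (kernel_op k) \<le> integral {0..1} \<Phi>"
proof (rule spectral_radius_le[OF bounded_linear_kernel_op])
  show "0 \<le> integral {0..1} \<Phi>"
    using bd[of 0] by (intro integral_nonneg \<Phi>) fastforce
qed (rule norm_kernel_op_le[OF bd \<Phi>])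

text \<open>A kernel that lies above the separated kernel \<open>c t * \<Phi> s\<close> has \<open>c\<close> as a subeigenvector,
  with the eigenvalue of the separated kernel as its factor.\<close>

lemma spectral_radius_kernel_op_ge:
  assumes c: "continuous_on {0..1} c" "\<And>t. t \<in> {0..1} \<Longrightarrow> 0 \<le> c t" "t0 \<in> {0..1}" "0 < c t0"
    and \<Phi>: "continuous_on {0..1} \<Phi>" "\<And>s. s \<in> {0..1} \<Longrightarrow> 0 \<le> \<Phi> s"
    and ge: "\<And>t s. t \<in> {0..1} \<Longrightarrow> s \<in> {0..1} \<Longrightarrow> c t * \<Phi> s \<le> k t s"
  shows "integral {0..1} (\<lambda>s. c s * \<Phi> s) \<le> spectral_radius (kernel_op k)"
proof -
  define v where "v = Bcontfun (\<lambda>x. c (ivl_val x))"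
  have v: "apply_bcontfun v x = c (ivl_val x)" for x
    unfolding v_def using bcontfun_of_continuous_on[OF c(1)] by (simp add: Bcontfun_inverse)
  have k0: "0 \<le> k t s" if "t \<in> {0..1}" "s \<in> {0..1}" for t s
    using ge[OF that] c(2)[OF that(1)] \<Phi>(2)[OF that(2)] by (meson mult_nonneg_nonneg order_trans)
  have int: "(\<lambda>s. c s * \<Phi> s) integrable_on {0..1}"
    by (intro integrable_continuous_real continuous_on_mult c \<Phi>)
  show ?thesis
  proof (rule spectral_radius_ge_of_subeigenvector[OF bounded_linear_kernel_op])
    fix u :: C01 and x assume "\<And>y. 0 \<le> apply_bcontfun u y"
    then show "0 \<le> apply_bcontfun (kernel_op k u) x"
      unfolding apply_kernel_op kernel_fun_def
      by (intro integral_nonneg kernel_integrable mult_nonneg_nonneg k0) (auto simp: ivl_val_bounds)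
  next
    show "0 \<le> integral {0..1} (\<lambda>s. c s * \<Phi> s)"
      by (intro integral_nonneg int mult_nonneg_nonneg c \<Phi>)
  next
    fix x
    have "integral {0..1} (\<lambda>s. c s * \<Phi> s) * c (ivl_val x)
        = integral {0..1} (\<lambda>s. c s * \<Phi> s * c (ivl_val x))" by simp
    also have "\<dots> \<le> integral {0..1} (\<lambda>s. k (ivl_val x) s * apply_bcontfun v (to_ivl s))"
    proof (rule integral_le)
      fix s :: real assume s: "s \<in> {0..1}"
      have "c (ivl_val x) * \<Phi> s * c s \<le> k (ivl_val x) s * c s"
        using s ivl_val_bounds by (intro mult_right_mono ge c) auto
      then show "c s * \<Phi> s * c (ivl_val x) \<le> k (ivl_val x) s * apply_bcontfun v (to_ivl s)"
        using s by (simp add: v to_ivl_inverse mult_ac)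
    qed (auto intro!: integrable_on_mult_left int kernel_integrable simp: ivl_val_bounds)
    finally show "integral {0..1} (\<lambda>s. c s * \<Phi> s) * apply_bcontfun v x \<le> apply_bcontfun (kernel_op k v) x"
      by (simp add: v apply_kernel_op kernel_fun_def)
  next
    show "0 < apply_bcontfun v (to_ivl t0)" using c by (simp add: v to_ivl_inverse)
  qed
qed

end

section \<open>Riemann--Stieltjes integrals of continuous functions\<close>

lemma tagged_division_real_cases:
  fixes a b :: real
  assumes "p tagged_division_of {a..b}" "(x, K) \<in> p"
  obtains c d where "K = {c..d}" "a \<le> c" "c \<le> x" "x \<le> d" "d \<le> b"
proof -
  obtain c d where K: "K = {c..d}"
    using tagged_division_ofD(4)[OF assms] by auto
  have "x \<in> K" "K \<subseteq> {a..b}"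
    using tagged_division_ofD(2,3)[OF assms] by auto
  then show ?thesis using that K by auto
qed

text \<open>Stated with an equation between the increments, so that it yields the difference
  rule both in the integrand and in the integrator.\<close>

lemma has_rs_integral_diff_increments:
  assumes "has_rs_integral f A a b I" "has_rs_integral g B a b J"
    and eq: "\<And>x c d. h x * (C d - C c) = f x * (A d - A c) - g x * (B d - B c)"
  shows "has_rs_integral h C a b (I - J)"
  unfolding has_rs_integral_def
proof (intro allI impI)
  fix e :: real assume "e > 0"
  then have e: "e / 2 > 0" by simp
  let ?S = "\<lambda>f A p. \<Sum>(x, k)\<in>p. f x * (A (Sup k) - A (Inf k))"
  obtain \<delta>1 where 1: "\<delta>1 > 0"
    "\<And>p. p tagged_division_of {a..b} \<Longrightarrow> \<forall>(x, k)\<in>p. Sup k - Inf k < \<delta>1 \<Longrightarrow> \<bar>?S f A p - I\<bar> < e / 2"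
    using assms(1) e unfolding has_rs_integral_def by meson
  obtain \<delta>2 where 2: "\<delta>2 > 0"
    "\<And>p. p tagged_division_of {a..b} \<Longrightarrow> \<forall>(x, k)\<in>p. Sup k - Inf k < \<delta>2 \<Longrightarrow> \<bar>?S g B p - J\<bar> < e / 2"
    using assms(2) e unfolding has_rs_integral_def by meson
  show "\<exists>\<delta>>0. \<forall>p. p tagged_division_of {a..b} \<and> (\<forall>(x, k)\<in>p. Sup k - Inf k < \<delta>) \<longrightarrow>
    \<bar>?S h C p - (I - J)\<bar> < e"
  proof (intro exI[of _ "min \<delta>1 \<delta>2"] conjI allI impI)
    fix p assume p: "p tagged_division_of {a..b} \<and> (\<forall>(x, k)\<in>p. Sup k - Inf k < min \<delta>1 \<delta>2)"
    have "\<bar>?S f A p - I\<bar> < e / 2" "\<bar>?S g B p - J\<bar> < e / 2"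
      using 1(2)[OF conjunct1[OF p]] 2(2)[OF conjunct1[OF p]] p by fastforce+
    moreover have "?S h C p = ?S f A p - ?S g B p"
      by (simp add: sum_subtractf[symmetric] case_prod_unfold eq)
    ultimately show "\<bar>?S h C p - (I - J)\<bar> < e" by linarith
  qed (use 1 2 in auto)
qed

lemma has_rs_integral_diff:
  assumes "has_rs_integral f A a b I" "has_rs_integral g A a b J"
  shows "has_rs_integral (\<lambda>x. f x - g x) A a b (I - J)"
  by (rule has_rs_integral_diff_increments[OF assms]) (simp add: left_diff_distrib)

lemma has_rs_integral_diff_integrator:
  assumes "has_rs_integral f V a b I" "has_rs_integral f W a b J"
  shows "has_rs_integral f (\<lambda>x. V x - W x) a b (I - J)"
  by (rule has_rs_integral_diff_increments[OF assms]) (simp add: algebra_simps)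

lemma rs_integral_norm_bound:
  assumes ab: "a \<le> b" and I: "has_rs_integral f A a b I"
    and f: "\<And>x. x \<in> {a..b} \<Longrightarrow> \<bar>f x\<bar> \<le> B"
    and V: "\<And>c d. a \<le> c \<Longrightarrow> c \<le> d \<Longrightarrow> d \<le> b \<Longrightarrow> \<bar>A d - A c\<bar> \<le> V d - V c"
  shows "\<bar>I\<bar> \<le> B * (V b - V a)"
proof (rule field_le_epsilon)
  fix e :: real assume "e > 0"
  let ?S = "\<lambda>p. \<Sum>(x, k)\<in>p. f x * (A (Sup k) - A (Inf k))"
  obtain \<delta> where \<delta>: "\<delta> > 0"
    "\<And>p. p tagged_division_of {a..b} \<Longrightarrow> \<forall>(x, k)\<in>p. Sup k - Inf k < \<delta> \<Longrightarrow> \<bar>?S p - I\<bar> < e"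
    using I \<open>e > 0\<close> unfolding has_rs_integral_def by meson
  obtain p where p: "p tagged_division_of {a..b}" "\<forall>(x, k)\<in>p. Sup k - Inf k < \<delta>"
    using small_mesh_exists[OF \<delta>(1)] by blast
  have "\<bar>?S p\<bar> \<le> (\<Sum>(x, k)\<in>p. \<bar>f x * (A (Sup k) - A (Inf k))\<bar>)"
    unfolding case_prod_unfold by (rule sum_abs)
  also have "\<dots> \<le> (\<Sum>(x, k)\<in>p. B * (V (Sup k) - V (Inf k)))"
  proof (rule sum_mono, clarify)
    fix x K assume "(x, K) \<in> p"
    with p(1) obtain c d where K: "K = {c..d}" "a \<le> c" "c \<le> x" "x \<le> d" "d \<le> b"
      by (rule tagged_division_real_cases)
    have "\<bar>f x\<bar> * \<bar>A d - A c\<bar> \<le> B * (V d - V c)"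
      using K f[of x] by (intro mult_mono V) auto
    then show "\<bar>f x * (A (Sup K) - A (Inf K))\<bar> \<le> B * (V (Sup K) - V (Inf K))"
      using K by (simp add: abs_mult)
  qed
  also have "\<dots> = B * (V b - V a)"
    using additive_tagged_division_1[OF ab p(1), of V]
    by (simp add: sum_distrib_left[symmetric] case_prod_unfold)
  finally show "\<bar>I\<bar> \<le> B * (V b - V a) + e"
    using \<delta>(2)[OF p] by linarith
qed

text \<open>The integral is the ordinary integral of \<open>f \<circ> q\<close> over \<open>[A a, A b]\<close>, where \<open>q\<close> is a
  generalized inverse of \<open>A\<close>. On \<open>[A c, A d)\<close> the inverse takes values in \<open>[c, d]\<close>, so on a
  short interval \<open>[c, d]\<close> the value of \<open>f\<close> at the tag is uniformly close to \<open>f \<circ> q\<close>; summed over a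
  division, the error is at most \<open>e' * (A b - A a)\<close>. No common refinement of two divisions is
  formed, and jumps of \<open>A\<close> require no special treatment: \<open>q\<close> is constant across a jump.\<close>

lemma has_rs_integral_mono_exists:
  assumes ab: "a \<le> b" and f: "continuous_on {a..b} f" and A: "mono_on {a..b} A"
  shows "\<exists>I. has_rs_integral f A a b I"
proof -
  \<comment> \<open>The inserted point \<open>a\<close> makes \<open>q\<close> monotone on the whole line, also below \<open>A a\<close>.\<close>
  define q where "q y = Sup (insert a {t\<in>{a..b}. A t \<le> y})" for y
  have bdd: "bdd_above (insert a {t\<in>{a..b}. A t \<le> y})" for y
    by (rule bdd_aboveI[where M = b]) (use ab in auto)
  have q_ge: "t \<le> q y" if "a \<le> t" "t \<le> b" "A t \<le> y" for t y
    unfolding q_def using that by (intro cSup_upper bdd) auto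
  have q_le: "q y \<le> t" if "a \<le> t" "\<And>t'. t < t' \<Longrightarrow> t' \<le> b \<Longrightarrow> y < A t'" for t y
    unfolding q_def
  proof (rule cSup_least)
    fix x assume x: "x \<in> insert a {t\<in>{a..b}. A t \<le> y}"
    show "x \<le> t"
    proof (rule ccontr)
      assume "\<not> x \<le> t"
      with x that(1) have "t < x" "x \<le> b" "A x \<le> y" by auto
      then show False using that(2) by force
    qed
  qed simp
  have q_range: "q y \<in> {a..b}" for y
  proof -
    have "a \<le> q y" unfolding q_def by (intro cSup_upper bdd) simp
    then show ?thesis using q_le[of b y] ab by auto
  qed
  have "mono_on UNIV q"
    unfolding q_def by (intro mono_onI cSup_subset_mono bdd) auto
  then have "q \<in> borel_measurable borel"
    using borel_measurable_mono_on_fnc[of UNIV q] by simp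
  then have "q \<in> measurable borel (restrict_space borel {a..b})"
    using q_range by (intro measurable_restrict_space2) auto
  then have h_meas: "(\<lambda>y. f (q y)) \<in> borel_measurable borel"
    by (rule measurable_compose[OF _ borel_measurable_continuous_on_restrict[OF f]])
  have "bounded (f ` {a..b})"
    by (intro compact_imp_bounded compact_continuous_image f) simp
  then obtain B where B: "\<And>x. x \<in> {a..b} \<Longrightarrow> \<bar>f x\<bar> \<le> B"
    unfolding bounded_iff by fastforce
  define h where "h y = f (q y)" for y
  have h_int: "h integrable_on {c..d}" for c d
  proof (rule measurable_bounded_by_integrable_imp_integrable)
    show "h \<in> borel_measurable (lebesgue_on {c..d})"
      unfolding h_def using h_meas
      by (intro measurable_restrict_space1 measurable_completion) simp
    show "(\<lambda>_. B) integrable_on {c..d}" by (rule integrable_const_ivl)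
  qed (use B q_range in \<open>auto simp: h_def\<close>)
  define F where "F t = integral {A a..A t} h" for t
  have F_diff: "F d - F c = integral {A c..A d} h" if "a \<le> c" "c \<le> d" "d \<le> b" for c d
  proof -
    have "A a \<le> A c" "A c \<le> A d" using that by (auto intro!: mono_onD[OF A])
    then show ?thesis
      unfolding F_def using Henstock_Kurzweil_Integration.integral_combine[OF _ _ h_int] by fastforce
  qed
  have "has_rs_integral f A a b (F b - F a)"
    unfolding has_rs_integral_def
  proof (intro allI impI)
    fix e :: real assume "e > 0"
    have Aab: "A a \<le> A b" using ab by (auto intro!: mono_onD[OF A])
    define e' where "e' = e / (A b - A a + 1)"
    have e': "e' > 0" "e' * (A b - A a) < e"
      using \<open>e > 0\<close> Aab by (auto simp: e'_def field_simps)
    have "uniformly_continuous_on {a..b} f"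
      by (intro compact_uniformly_continuous f) simp
    then obtain \<delta> where \<delta>: "\<delta> > 0"
      "\<And>x x'. x \<in> {a..b} \<Longrightarrow> x' \<in> {a..b} \<Longrightarrow> \<bar>x - x'\<bar> < \<delta> \<Longrightarrow> \<bar>f x - f x'\<bar> < e'"
      unfolding uniformly_continuous_on_def dist_real_def using e'(1) by (metis abs_minus_commute)
    let ?S = "\<lambda>p. \<Sum>(x, k)\<in>p. f x * (A (Sup k) - A (Inf k))"
    show "\<exists>\<delta>>0. \<forall>p. p tagged_division_of {a..b} \<and> (\<forall>(x, k)\<in>p. Sup k - Inf k < \<delta>) \<longrightarrow>
      \<bar>?S p - (F b - F a)\<bar> < e"
    proof (intro exI[of _ \<delta>] conjI allI impI)
      fix p assume p': "p tagged_division_of {a..b} \<and> (\<forall>(x, k)\<in>p. Sup k - Inf k < \<delta>)"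
      then have p: "p tagged_division_of {a..b}" by simp
      have "\<bar>?S p - (F b - F a)\<bar>
          = \<bar>\<Sum>(x, k)\<in>p. f x * (A (Sup k) - A (Inf k)) - (F (Sup k) - F (Inf k))\<bar>"
        using additive_tagged_division_1[OF ab p, of F]
        by (simp add: sum_subtractf case_prod_unfold)
      also have "\<dots> \<le> (\<Sum>(x, k)\<in>p. \<bar>f x * (A (Sup k) - A (Inf k)) - (F (Sup k) - F (Inf k))\<bar>)"
        unfolding case_prod_unfold by (rule sum_abs)
      also have "\<dots> \<le> (\<Sum>(x, k)\<in>p. e' * (A (Sup k) - A (Inf k)))"
      proof (rule sum_mono, clarify)
        fix x K assume xK: "(x, K) \<in> p"
        with p obtain c d where K: "K = {c..d}" "a \<le> c" "c \<le> x" "x \<le> d" "d \<le> b"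
          by (rule tagged_division_real_cases)
        have "d - c < \<delta>" using p' xK K by fastforce
        have Acd: "A c \<le> A d" using K by (auto intro!: mono_onD[OF A])
        \<comment> \<open>At \<open>y = A d\<close> the inverse may lie beyond \<open>d\<close>, if \<open>A\<close> is constant to the right of
          \<open>d\<close>; one point does not change the integral.\<close>
        have "\<bar>f x - h y\<bar> \<le> e'" if y: "y \<in> {A c..A d} - {A d}" for y
        proof -
          have "c \<le> q y" using K y by (intro q_ge) auto
          moreover have "q y \<le> d"
          proof (rule q_le)
            fix t' assume "d < t'" "t' \<le> b"
            then have "A d \<le> A t'" using K by (auto intro!: mono_onD[OF A])
            then show "y < A t'" using y by auto
          qed (use K in auto)
          ultimately have "\<bar>x - q y\<bar> < \<delta>" using K \<open>d - c < \<delta>\<close> by linarith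
          then have "\<bar>f x - f (q y)\<bar> < e'" using K q_range[of y] by (intro \<delta>) auto
          then show ?thesis by (simp add: h_def)
        qed
        moreover have "((\<lambda>y. f x - h y) has_integral (f x * (A d - A c) - integral {A c..A d} h)) (cbox (A c) (A d))"
          using has_integral_diff[OF has_integral_const_real[of "f x" "A c" "A d"]
              integrable_integral[OF h_int]] Acd
          by (simp add: mult.commute)
        ultimately have "norm (f x * (A d - A c) - integral {A c..A d} h)
            \<le> e' * measure lborel (cbox (A c) (A d))"
          using e'(1) by (intro has_integral_bound_spike_finite[where S = "{A d}"]) auto
        then have "\<bar>f x * (A d - A c) - (F d - F c)\<bar> \<le> e' * (A d - A c)"
          using Acd F_diff[of c d] K by simp
        then show "\<bar>f x * (A (Sup K) - A (Inf K)) - (F (Sup K) - F (Inf K))\<bar>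
            \<le> e' * (A (Sup K) - A (Inf K))"
          using K by simp
      qed
      also have "\<dots> = e' * (A b - A a)"
        using additive_tagged_division_1[OF ab p, of A]
        by (simp add: sum_distrib_left[symmetric] case_prod_unfold)
      finally show "\<bar>?S p - (F b - F a)\<bar> < e" using e'(2) by linarith
    qed (rule \<delta>)
  qed
  then show ?thesis ..
qed

lemma division_extend_right:
  fixes a c e :: real
  assumes d: "d division_of {a..c}" and ac: "a \<le> c" "c < e"
  shows "insert {c..e} d division_of {a..e}" and "{c..e} \<notin> d"
proof -
  have "d \<union> {{c..e}} division_of {a..c} \<union> {c..e}"
    using ac division_of_self[of c e] by (intro division_disjoint_union d) auto
  then show "insert {c..e} d division_of {a..e}"
    using ac by (simp add: ivl_disj_un_two_touch)
  show "{c..e} \<notin> d"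
    using division_ofD(2)[OF d] ac by fastforce
qed

text \<open>The function \<open>V\<close> is the variation of \<open>A\<close> on \<open>[a, t]\<close>. The increment inequality is all that is
  used of it: it makes both \<open>V\<close> and \<open>V - A\<close> monotone, which is the Jordan decomposition, and it
  controls Riemann--Stieltjes sums for \<open>A\<close> by telescoping sums for \<open>V\<close>.\<close>

lemma bounded_variation_dominated:
  assumes "bounded_variation_on A a b"
  obtains V where
    "\<And>c d. a \<le> c \<Longrightarrow> c \<le> d \<Longrightarrow> d \<le> b \<Longrightarrow> \<bar>A d - A c\<bar> \<le> V d - V c"
proof -
  obtain M where M: "\<And>d. d division_of {a..b} \<Longrightarrow> (\<Sum>k\<in>d. \<bar>A (Sup k) - A (Inf k)\<bar>) \<le> M"
    using assms unfolding bounded_variation_on_def by blast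
  let ?v = "\<lambda>d. \<Sum>k\<in>d. \<bar>A (Sup k) - A (Inf k)\<bar>"
  have ext: "?v (insert {c..e} d) = \<bar>A e - A c\<bar> + ?v d"
    if "d division_of {a..c}" "a \<le> c" "c < e" for d c e
    using division_extend_right(2)[OF that] division_ofD(1)[OF that(1)] that by simp
  define V where "V t = (SUP d\<in>{d. d division_of {a..t}}. ?v d)" for t
  have bdd: "bdd_above (?v ` {d. d division_of {a..t}})" if t: "a \<le> t" "t \<le> b" for t
  proof (rule bdd_aboveI2)
    fix d assume "d \<in> {d. d division_of {a..t}}"
    then have d: "d division_of {a..t}" by simp
    show "?v d \<le> M"
    proof (cases "t = b")
      case False
      then show ?thesis
        using M[OF division_extend_right(1)[OF d, of b]] ext[OF d, of b] t by simp
    qed (use M d in simp)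
  qed
  have "\<bar>A d - A c\<bar> \<le> V d - V c" if cd: "a \<le> c" "c \<le> d" "d \<le> b" for c d
  proof (cases "c = d")
    case False
    have "V c \<le> V d - \<bar>A d - A c\<bar>"
      unfolding V_def[of c]
    proof (rule cSUP_least)
      show "{p. p division_of {a..c}} \<noteq> {}"
        using division_of_self[of a c] cd by auto
      fix p assume "p \<in> {p. p division_of {a..c}}"
      then have p: "p division_of {a..c}" by simp
      have "?v (insert {c..d} p) \<le> V d"
        unfolding V_def using cd False
        by (intro cSUP_upper bdd) (auto intro!: division_extend_right p)
      then show "?v p \<le> V d - \<bar>A d - A c\<bar>"
        using ext[OF p, of d] cd False by simp
    qed
    then show ?thesis by simp
  qed simp
  then show ?thesis by (rule that)
qed

lemma has_rs_integral_rs_integral: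
  assumes ab: "a \<le> b" and f: "continuous_on {a..b} f" and A: "bounded_variation_on A a b"
  shows "has_rs_integral f A a b (rs_integral f A a b)"
proof -
  obtain V where V: "\<And>c d. a \<le> c \<Longrightarrow> c \<le> d \<Longrightarrow> d \<le> b \<Longrightarrow> \<bar>A d - A c\<bar> \<le> V d - V c"
    using bounded_variation_dominated[OF A] by blast
  have "mono_on {a..b} V" "mono_on {a..b} (\<lambda>x. V x - A x)"
    using V by (force intro!: mono_onI)+
  then obtain I J where "has_rs_integral f V a b I" "has_rs_integral f (\<lambda>x. V x - A x) a b J"
    using has_rs_integral_mono_exists[OF ab f] by blast
  then have "has_rs_integral f A a b (I - J)"
    using has_rs_integral_diff_integrator by fastforce
  then show ?thesis using rs_integral_unique by metis
qed

text \<open>Uniform continuity of \<open>f\<close> on the compact product makes the integrands for nearby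
  parameters uniformly close, and the integral of a uniformly small function is small by
  \<open>rs_integral_norm_bound\<close>.\<close>

lemma continuous_on_rs_integral:
  fixes f :: "real \<Rightarrow> 'a::metric_space \<Rightarrow> real"
  assumes ab: "a \<le> b" and A: "bounded_variation_on A a b" and S: "compact S"
    and f: "continuous_on ({a..b} \<times> S) (\<lambda>(t, s). f t s)"
  shows "continuous_on S (\<lambda>s. rs_integral (\<lambda>t. f t s) A a b)"
  unfolding continuous_on_iff
proof (intro ballI allI impI)
  fix s and e :: real assume s: "s \<in> S" and e: "e > 0"
  obtain V where V: "\<And>c d. a \<le> c \<Longrightarrow> c \<le> d \<Longrightarrow> d \<le> b \<Longrightarrow> \<bar>A d - A c\<bar> \<le> V d - V c"
    using bounded_variation_dominated[OF A] by blast
  have Vab: "0 \<le> V b - V a" using V[of a b] ab by linarith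
  define e' where "e' = e / (V b - V a + 1)"
  have e': "e' > 0" "e' * (V b - V a) < e" using e Vab by (auto simp: e'_def field_simps)
  have "uniformly_continuous_on ({a..b} \<times> S) (\<lambda>(t, s). f t s)"
    by (intro compact_uniformly_continuous f compact_Times S) simp
  then obtain \<delta> where \<delta>: "\<delta> > 0"
    "\<And>p q. p \<in> {a..b} \<times> S \<Longrightarrow> q \<in> {a..b} \<times> S \<Longrightarrow> dist q p < \<delta> \<Longrightarrow>
      dist (case_prod f q) (case_prod f p) < e'"
    unfolding uniformly_continuous_on_def using e'(1) by metis
  have I: "has_rs_integral (\<lambda>t. f t s) A a b (rs_integral (\<lambda>t. f t s) A a b)" if "s \<in> S" for s
  proof (rule has_rs_integral_rs_integral[OF ab _ A])
    show "continuous_on {a..b} (\<lambda>t. f t s)"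
      using continuous_on_compose2[OF f, of "{a..b}" "\<lambda>t. (t, s)"] that
      by (force intro: continuous_intros)
  qed
  show "\<exists>\<delta>>0. \<forall>s'\<in>S. dist s' s < \<delta> \<longrightarrow>
    dist (rs_integral (\<lambda>t. f t s') A a b) (rs_integral (\<lambda>t. f t s) A a b) < e"
  proof (intro exI[of _ \<delta>] conjI ballI impI)
    fix s' assume s': "s' \<in> S" "dist s' s < \<delta>"
    have "\<bar>f t s' - f t s\<bar> \<le> e'" if "t \<in> {a..b}" for t
      using \<delta>(2)[of "(t, s)" "(t, s')"] s s' that by (simp add: dist_Pair_Pair dist_real_def)
    then have "\<bar>rs_integral (\<lambda>t. f t s') A a b - rs_integral (\<lambda>t. f t s) A a b\<bar> \<le> e' * (V b - V a)"
      by (intro rs_integral_norm_bound[OF ab has_rs_integral_diff[OF I I] _ V] s s')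
    then show "dist (rs_integral (\<lambda>t. f t s') A a b) (rs_integral (\<lambda>t. f t s) A a b) < e"
      using e'(2) by (simp add: dist_real_def)
  qed (rule \<delta>)
qed

section \<open>The Green's function and its two-sided bounds\<close>

text \<open>The two branches merge because \<^term>\<open>(0::real) powr x\<close> is 0. This form is visibly
  continuous.\<close>

lemma G_eq_max:
  "G \<alpha> t s = (t * (1 - s) powr (\<alpha> - 1) - max 0 (t - s) powr (\<alpha> - 1)) / Gamma \<alpha>"
  by (simp add: G_def max_def)

lemma continuous_on_G:
  assumes "1 < \<alpha>"
  shows "continuous_on ({0..1} \<times> {0..1}) (\<lambda>(t, s). G \<alpha> t s)"
  unfolding G_eq_max case_prod_unfold
  using assms by (intro continuous_intros continuous_on_powr') (auto simp: Gamma_eq_zero_iff)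

lemma continuous_on_\<Psi>:
  assumes "1 < \<alpha>"
  shows "continuous_on {0..1} (\<Psi> \<alpha>)"
  unfolding \<Psi>_def
  using assms by (intro continuous_intros continuous_on_powr') (auto simp: Gamma_eq_zero_iff)

lemma \<Psi>_nonneg: "1 < \<alpha> \<Longrightarrow> 0 \<le> \<Psi> \<alpha> s"
  by (simp add: \<Psi>_def Gamma_real_nonneg)

lemma G_le:
  assumes "1 < \<alpha>"
  shows "G \<alpha> t s \<le> t * \<Psi> \<alpha> s"
  using assms Gamma_real_pos[of \<alpha>] by (simp add: G_eq_max \<Psi>_def divide_right_mono)

text \<open>The subtracted term is controlled by \<open>t - s \<le> t * (1 - s)\<close>, which lets the power of \<open>t\<close>
  split off from \<open>\<Psi>\<close>.\<close>

lemma G_ge: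
  assumes "1 < \<alpha>" and ts: "t \<in> {0..1}" "s \<in> {0..1}"
  shows "(t - t powr (\<alpha> - 1)) * \<Psi> \<alpha> s \<le> G \<alpha> t s"
proof -
  have "t * s \<le> s" using ts by (simp add: mult_left_le_one_le)
  then have "t - s \<le> t * (1 - s)" by (simp add: right_diff_distrib)
  moreover have "0 \<le> t * (1 - s)" using ts by simp
  ultimately have "max 0 (t - s) \<le> t * (1 - s)" by simp
  then have "max 0 (t - s) powr (\<alpha> - 1) \<le> (t * (1 - s)) powr (\<alpha> - 1)"
    using assms by (intro powr_mono2) auto
  also have "\<dots> = t powr (\<alpha> - 1) * (1 - s) powr (\<alpha> - 1)"
    using ts by (simp add: powr_mult)
  finally show ?thesis
    using assms Gamma_real_pos[of \<alpha>] by (simp add: G_eq_max \<Psi>_def left_diff_distrib divide_right_mono)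
qed

lemma has_integral_\<Psi>:
  assumes "1 < \<alpha>"
  shows "(\<Psi> \<alpha> has_integral 1 / Gamma (\<alpha> + 1)) {0..1}"
proof -
  have "((\<lambda>s. (1 - s) powr (\<alpha> - 1)) has_integral
      - ((1 - 1) powr \<alpha> / \<alpha>) - - ((1 - 0) powr \<alpha> / \<alpha>)) {0..1::real}"
  proof (rule fundamental_theorem_of_calculus_interior)
    show "continuous_on {0..1} (\<lambda>s. - ((1 - s) powr \<alpha> / \<alpha>))"
      using assms by (intro continuous_intros continuous_on_powr') auto
    fix s :: real assume "s \<in> {0<..<1}"
    then have "((\<lambda>s. - ((1 - s) powr \<alpha> / \<alpha>)) has_real_derivative (1 - s) powr (\<alpha> - 1)) (at s)"
      using assms by (auto intro!: derivative_eq_intros simp: powr_diff field_simps)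
    then show "((\<lambda>s. - ((1 - s) powr \<alpha> / \<alpha>)) has_vector_derivative (1 - s) powr (\<alpha> - 1)) (at s)"
      by (simp add: has_real_derivative_iff_has_vector_derivative)
  qed simp
  from has_integral_divide[OF this, of "Gamma \<alpha>"]
  have "(\<Psi> \<alpha> has_integral 1 / (\<alpha> * Gamma \<alpha>)) {0..1}"
    by (simp add: \<Psi>_def[abs_def])
  moreover have "Gamma (\<alpha> + 1) = \<alpha> * Gamma \<alpha>"
    using assms by (intro Gamma_plus1) (auto simp: nonpos_Ints_def)
  ultimately show ?thesis by simp
qed

lemma powr_le_self:
  fixes t :: real
  assumes "1 \<le> p" "t \<in> {0..1}"
  shows "t powr p \<le> t"
  using powr_mono'[of 1 p t] assms by simp

text \<open>The function of \<open>s\<close> alone obtained from \<^term>\<open>H\<close> when \<open>t\<close> is replaced by 1 and both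
  values of \<^term>\<open>G\<close> are replaced by \<^term>\<open>\<Psi>\<close>; \<open>majorant_eq\<close> shows it in that form.\<close>

definition majorant :: "real \<Rightarrow> real \<Rightarrow> real \<Rightarrow> real \<Rightarrow> (real \<Rightarrow> real) \<Rightarrow> real \<Rightarrow> real" where
  "majorant \<alpha> \<eta> \<mu> \<beta> A s =
     (\<beta> * gA \<alpha> A s + (\<mu> - Lam \<eta> \<mu> \<beta> A + 1) * \<Psi> \<alpha> s) / (1 - Lam \<eta> \<mu> \<beta> A)"

lemma continuous_on_gA:
  assumes "1 < \<alpha>" "bounded_variation_on A 0 1"
  shows "continuous_on {0..1} (gA \<alpha> A)"
  unfolding gA_def using assms
  by (intro continuous_on_rs_integral[where f = "G \<alpha>"] continuous_on_G) auto

lemma continuous_on_H: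
  assumes "1 < \<alpha>" "bounded_variation_on A 0 1" "\<eta> \<in> {0..1}" "Lam \<eta> \<mu> \<beta> A < 1"
  shows "continuous_on ({0..1} \<times> {0..1}) (\<lambda>(t, s). H \<alpha> \<eta> \<mu> \<beta> A t s)"
proof -
  have "continuous_on ({0..1} \<times> {0..1}) (\<lambda>p::real \<times> real. gA \<alpha> A (snd p))"
    by (rule continuous_on_compose2[OF continuous_on_gA[OF assms(1,2)]])
      (auto intro: continuous_intros)
  moreover have "continuous_on ({0..1} \<times> {0..1}) (\<lambda>p::real \<times> real. G \<alpha> \<eta> (snd p))"
    using continuous_on_compose2[OF continuous_on_G[OF assms(1)], of "{0..1} \<times> {0..1}"
        "\<lambda>p::real \<times> real. (\<eta>, snd p)"] assms(3)
    by (force intro: continuous_intros)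
  ultimately show ?thesis
    unfolding H_def case_prod_unfold using assms continuous_on_G[OF assms(1)]
    by (intro continuous_intros) (auto simp: case_prod_unfold)
qed

context
  fixes \<alpha> \<eta> \<mu> \<beta> :: real and A :: "real \<Rightarrow> real"
  assumes \<alpha>: "2 \<le> \<alpha>" and \<eta>: "\<eta> \<in> {0..1}" and nonneg: "0 \<le> \<mu>" "0 \<le> \<beta>"
    and Lam: "Lam \<eta> \<mu> \<beta> A < 1" and gA: "\<And>s. s \<in> {0..1} \<Longrightarrow> 0 \<le> gA \<alpha> A s"
begin

lemma majorant_eq:
  "majorant \<alpha> \<eta> \<mu> \<beta> A s = \<beta> / (1 - Lam \<eta> \<mu> \<beta> A) * gA \<alpha> A s
     + \<mu> / (1 - Lam \<eta> \<mu> \<beta> A) * \<Psi> \<alpha> s + \<Psi> \<alpha> s"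
proof -
  have "(b + (\<mu> + d) * p) / d = b / d + \<mu> / d * p + p" if "d \<noteq> 0" for b d p :: real
    using that by (simp add: field_simps)
  from this[of "1 - Lam \<eta> \<mu> \<beta> A" "\<beta> * gA \<alpha> A s" "\<Psi> \<alpha> s"] show ?thesis
    using Lam by (simp add: majorant_def add_diff_eq diff_add_eq)
qed

lemma majorant_nonneg: "s \<in> {0..1} \<Longrightarrow> 0 \<le> majorant \<alpha> \<eta> \<mu> \<beta> A s"
  unfolding majorant_eq using \<alpha> nonneg Lam gA
  by (intro add_nonneg_nonneg mult_nonneg_nonneg \<Psi>_nonneg) auto

lemma H_le_majorant:
  assumes ts: "t \<in> {0..1}" "s \<in> {0..1}"
  shows "H \<alpha> \<eta> \<mu> \<beta> A t s \<le> majorant \<alpha> \<eta> \<mu> \<beta> A s"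
proof -
  let ?b = "\<beta> / (1 - Lam \<eta> \<mu> \<beta> A)" and ?m = "\<mu> / (1 - Lam \<eta> \<mu> \<beta> A)"
  have bm: "0 \<le> ?b" "0 \<le> ?m" using nonneg Lam by auto
  have G1: "G \<alpha> r s \<le> \<Psi> \<alpha> s" if "r \<in> {0..1}" for r
    using G_le[of \<alpha> r s] \<Psi>_nonneg[of \<alpha> s] \<alpha> that mult_left_le_one_le[of "\<Psi> \<alpha> s" r] by simp
  have "t * gA \<alpha> A s \<le> gA \<alpha> A s"
    using ts gA[OF ts(2)] by (intro mult_left_le_one_le) auto
  then have "?b * (t * gA \<alpha> A s) \<le> ?b * gA \<alpha> A s" by (intro mult_left_mono bm)
  moreover have "t * G \<alpha> \<eta> s \<le> \<Psi> \<alpha> s"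
    using mult_left_mono[OF G1[OF \<eta>], of t] mult_left_le_one_le[of "\<Psi> \<alpha> s" t] \<Psi>_nonneg[of \<alpha> s] \<alpha> ts
    by simp
  then have "?m * (t * G \<alpha> \<eta> s) \<le> ?m * \<Psi> \<alpha> s" by (intro mult_left_mono bm)
  ultimately show ?thesis
    using G1[OF ts(1)] unfolding H_def majorant_eq by simp
qed

text \<open>Each of the three summands of \<open>H\<close> is bounded separately. Write \<open>c t = t - t\<^sup>\<alpha>\<^sup>-\<^sup>1\<close>. The factor
  \<open>c \<eta>\<close> arises in the middle summand, where \<open>G \<eta> s \<ge> c \<eta> * \<Psi> s\<close>; the others can absorb it because
  \<open>0 \<le> c \<eta> \<le> 1\<close>.\<close>

lemma H_ge_majorant:
  assumes ts: "t \<in> {0..1}" "s \<in> {0..1}"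
  shows "(t - t powr (\<alpha> - 1)) * ((\<eta> - \<eta> powr (\<alpha> - 1)) * majorant \<alpha> \<eta> \<mu> \<beta> A s) \<le> H \<alpha> \<eta> \<mu> \<beta> A t s"
proof -
  let ?b = "\<beta> / (1 - Lam \<eta> \<mu> \<beta> A)" and ?m = "\<mu> / (1 - Lam \<eta> \<mu> \<beta> A)"
  let ?c = "\<lambda>t::real. t - t powr (\<alpha> - 1)"
  have bm: "0 \<le> ?b" "0 \<le> ?m" using nonneg Lam by auto
  have c: "0 \<le> ?c r" "?c r \<le> r" if "r \<in> {0..1}" for r
    using powr_le_self[of "\<alpha> - 1" r] \<alpha> that by auto
  have c\<eta>: "0 \<le> ?c \<eta>" "?c \<eta> \<le> 1"
    using c(1)[OF \<eta>] order_trans[OF c(2)[OF \<eta>], of 1] \<eta> by auto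
  have P: "0 \<le> \<Psi> \<alpha> s" using \<alpha> by (intro \<Psi>_nonneg) simp
  have 1: "?c t * ?c \<eta> \<le> t"
    using mult_mono[OF c(2)[OF ts(1)] c\<eta>(2)] c[OF ts(1)] c\<eta> ts by simp
  have "?b * (?c t * ?c \<eta> * gA \<alpha> A s) \<le> ?b * (t * gA \<alpha> A s)"
    by (intro mult_left_mono mult_right_mono 1 bm gA ts)
  moreover have "?m * (?c t * (?c \<eta> * \<Psi> \<alpha> s)) \<le> ?m * (t * G \<alpha> \<eta> s)"
    using \<alpha> ts \<eta> c c\<eta> P by (intro mult_left_mono mult_mono G_ge bm) auto
  moreover have "?c t * ?c \<eta> * \<Psi> \<alpha> s \<le> G \<alpha> t s"
  proof -
    have "?c t * ?c \<eta> * \<Psi> \<alpha> s \<le> ?c t * \<Psi> \<alpha> s"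
      using mult_left_mono[OF c\<eta>(2) c(1)[OF ts(1)]] P by (intro mult_right_mono) auto
    also have "\<dots> \<le> G \<alpha> t s" using \<alpha> ts by (intro G_ge) auto
    finally show ?thesis .
  qed
  moreover have "?c t * (?c \<eta> * majorant \<alpha> \<eta> \<mu> \<beta> A s) =
      ?b * (?c t * ?c \<eta> * gA \<alpha> A s) + ?m * (?c t * (?c \<eta> * \<Psi> \<alpha> s)) + ?c t * ?c \<eta> * \<Psi> \<alpha> s"
    unfolding majorant_eq by (simp only: distrib_left mult_ac)
  moreover have "H \<alpha> \<eta> \<mu> \<beta> A t s = ?b * (t * gA \<alpha> A s) + ?m * (t * G \<alpha> \<eta> s) + G \<alpha> t s"
    unfolding H_def by simp
  ultimately show ?thesis by linarith
qed

lemma continuous_on_majorant: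
  assumes "bounded_variation_on A 0 1"
  shows "continuous_on {0..1} (majorant \<alpha> \<eta> \<mu> \<beta> A)"
  unfolding majorant_def[abs_def] using Lam \<alpha> assms
  by (intro continuous_intros continuous_on_gA continuous_on_\<Psi>) auto

lemma integral_majorant:
  assumes "bounded_variation_on A 0 1"
  shows "integral {0..1} (majorant \<alpha> \<eta> \<mu> \<beta> A) = \<tau>2 \<alpha> \<eta> \<mu> \<beta> A"
proof -
  have "(gA \<alpha> A has_integral integral {0..1} (gA \<alpha> A)) {0..1}"
    using \<alpha> assms by (intro integrable_integral integrable_continuous_real continuous_on_gA) auto
  moreover have "(\<Psi> \<alpha> has_integral 1 / Gamma (\<alpha> + 1)) {0..1}"
    using \<alpha> by (intro has_integral_\<Psi>) simp
  ultimately have "(majorant \<alpha> \<eta> \<mu> \<beta> A has_integral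
      (\<beta> * integral {0..1} (gA \<alpha> A) + (\<mu> - Lam \<eta> \<mu> \<beta> A + 1) * (1 / Gamma (\<alpha> + 1)))
        / (1 - Lam \<eta> \<mu> \<beta> A)) {0..1}"
    unfolding majorant_def[abs_def]
    by (intro has_integral_divide has_integral_add has_integral_mult_right)
  then show ?thesis by (simp add: integral_unique \<tau>2_def)
qed

end

text \<open>This exhibits \<^term>\<open>\<tau>1\<close> as the eigenvalue of the separated kernel that lies below
  \<^term>\<open>H\<close>.\<close>

lemma \<tau>1_eq_integral_majorant:
  "\<tau>1 \<alpha> \<eta> \<mu> \<beta> A = integral {0..1}
     (\<lambda>s. (s - s powr (\<alpha> - 1)) * ((\<eta> - \<eta> powr (\<alpha> - 1)) * majorant \<alpha> \<eta> \<mu> \<beta> A s))"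
proof -
  have "\<tau>1 \<alpha> \<eta> \<mu> \<beta> A = integral {0..1} (\<lambda>s. (\<eta> - \<eta> powr (\<alpha> - 1)) / (1 - Lam \<eta> \<mu> \<beta> A) *
      ((s - s powr (\<alpha> - 1)) * (\<beta> * gA \<alpha> A s + (\<mu> - Lam \<eta> \<mu> \<beta> A + 1) * \<Psi> \<alpha> s)))"
    unfolding \<tau>1_def by simp
  then show ?thesis by (simp add: majorant_def mult_ac)
qed

section \<open>The spectral radius estimate\<close>

lemma kernel_fun_scale: "kernel_fun (\<lambda>t s. a * k t s) u t = a * kernel_fun k u t"
  by (simp add: kernel_fun_def mult.assoc)

theorem lemma2p12:
  fixes \<alpha> \<eta> \<mu> \<beta> a :: real and A :: "real \<Rightarrow> real"
  assumes "2 < \<alpha>" and "\<alpha> \<le> 3"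
    and "0 < \<eta>" and "\<eta> < 1"
    and "\<mu> \<ge> 0" and "\<beta> \<ge> 0"
    and "bounded_variation_on A 0 1"
    and "0 \<le> Lam \<eta> \<mu> \<beta> A" and "Lam \<eta> \<mu> \<beta> A < 1"
    and "\<forall>s\<in>{0..1}. gA \<alpha> A s \<ge> 0"
    and "a > 0"
  shows "(\<forall>u t. apply_bcontfun (K_op \<alpha> \<eta> \<mu> \<beta> A u) t = K_fun \<alpha> \<eta> \<mu> \<beta> A u t)
    \<and> bounded_linear (Ka_op \<alpha> \<eta> \<mu> \<beta> A a)
    \<and> convergent (\<lambda>n. root n (onorm (Ka_op \<alpha> \<eta> \<mu> \<beta> A a ^^ n)))
    \<and> a * \<tau>1 \<alpha> \<eta> \<mu> \<beta> A \<le> spectral_radius (Ka_op \<alpha> \<eta> \<mu> \<beta> A a)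
    \<and> spectral_radius (Ka_op \<alpha> \<eta> \<mu> \<beta> A a) \<le> a * \<tau>2 \<alpha> \<eta> \<mu> \<beta> A"
proof -
  note Lam = \<open>Lam \<eta> \<mu> \<beta> A < 1\<close> and BV = \<open>bounded_variation_on A 0 1\<close> and a = \<open>a > 0\<close>
  have \<alpha>: "1 < \<alpha>" "2 \<le> \<alpha>" and \<eta>: "\<eta> \<in> {0..1}" using assms by auto
  have gA: "0 \<le> gA \<alpha> A s" if "s \<in> {0..1}" for s using assms that by blast
  note hyps = \<alpha>(2) \<eta> \<open>\<mu> \<ge> 0\<close> \<open>\<beta> \<ge> 0\<close> Lam gA
  let ?H = "H \<alpha> \<eta> \<mu> \<beta> A" and ?\<Phi> = "majorant \<alpha> \<eta> \<mu> \<beta> A"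
  let ?c = "\<lambda>t::real. t - t powr (\<alpha> - 1)" and ?k = "\<lambda>t s. a * H \<alpha> \<eta> \<mu> \<beta> A t s"
  have cont_H: "continuous_on ({0..1} \<times> {0..1}) (\<lambda>(t, s). ?H t s)"
    by (rule continuous_on_H[OF \<alpha>(1) BV \<eta> Lam])
  have cont_k: "continuous_on ({0..1} \<times> {0..1}) (\<lambda>(t, s). ?k t s)"
    using continuous_on_mult_left[OF cont_H, of a] by (simp add: case_prod_unfold)
  have cont_\<Phi>: "continuous_on {0..1} ?\<Phi>"
    by (rule continuous_on_majorant[OF hyps BV])
  have K_fun: "K_fun \<alpha> \<eta> \<mu> \<beta> A = kernel_fun ?H"
    by (intro ext) (simp add: K_fun_def kernel_fun_def)
  then have "K_op \<alpha> \<eta> \<mu> \<beta> A = kernel_op ?H"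
    by (intro ext) (simp add: K_op_def kernel_op_def)
  then have K_op: "apply_bcontfun (K_op \<alpha> \<eta> \<mu> \<beta> A u) t = K_fun \<alpha> \<eta> \<mu> \<beta> A u t" for u t
    using apply_kernel_op[OF cont_H] K_fun by simp
  have Ka_op: "Ka_op \<alpha> \<eta> \<mu> \<beta> A a = kernel_op ?k"
    by (intro ext bcontfun_eqI)
      (simp add: Ka_op_def K_op K_fun apply_kernel_op[OF cont_k] kernel_fun_scale)
  have c: "0 \<le> ?c t" if "t \<in> {0..1}" for t
    using powr_le_self[of "\<alpha> - 1" t] \<alpha> that by auto
  have c\<eta>: "0 < ?c \<eta>"
    using powr_less_mono'[of \<eta> 1 "\<alpha> - 1"] assms by simp
  have H_ge: "?c t * (?c \<eta> * ?\<Phi> s) \<le> ?H t s" if "t \<in> {0..1}" "s \<in> {0..1}" for t s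
    by (rule H_ge_majorant[OF hyps that])
  have H_nonneg: "0 \<le> ?H t s" if "t \<in> {0..1}" "s \<in> {0..1}" for t s
    using that c c\<eta> majorant_nonneg[OF hyps] by (intro order_trans[OF _ H_ge] mult_nonneg_nonneg) auto
  have lower: "a * \<tau>1 \<alpha> \<eta> \<mu> \<beta> A \<le> spectral_radius (kernel_op ?k)"
  proof -
    have "integral {0..1} (\<lambda>s. ?c s * (a * (?c \<eta> * ?\<Phi> s))) \<le> spectral_radius (kernel_op ?k)"
    proof (rule spectral_radius_kernel_op_ge[OF cont_k])
      show "continuous_on {0..1} ?c"
        using \<alpha> by (intro continuous_intros continuous_on_powr') auto
      show "continuous_on {0..1} (\<lambda>s. a * (?c \<eta> * ?\<Phi> s))"
        by (intro continuous_on_mult_left cont_\<Phi>)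
      show "0 \<le> a * (?c \<eta> * ?\<Phi> s)" if "s \<in> {0..1}" for s
        using a c\<eta> majorant_nonneg[OF hyps that] by simp
      show "?c t * (a * (?c \<eta> * ?\<Phi> s)) \<le> a * ?H t s" if "t \<in> {0..1}" "s \<in> {0..1}" for t s
        using mult_left_mono[OF H_ge[OF that], of a] a by (simp add: mult_ac)
    qed (use c c\<eta> \<eta> in auto)
    moreover have "(\<lambda>s. ?c s * (a * (?c \<eta> * ?\<Phi> s))) = (\<lambda>s. a * (?c s * (?c \<eta> * ?\<Phi> s)))"
      by (simp add: mult_ac)
    ultimately show ?thesis by (simp only: \<tau>1_eq_integral_majorant integral_mult_right)
  qed
  have upper: "spectral_radius (kernel_op ?k) \<le> a * \<tau>2 \<alpha> \<eta> \<mu> \<beta> A"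
  proof -
    have "spectral_radius (kernel_op ?k) \<le> integral {0..1} (\<lambda>s. a * ?\<Phi> s)"
    proof (rule spectral_radius_kernel_op_le[OF cont_k])
      show "\<bar>a * ?H t s\<bar> \<le> a * ?\<Phi> s" if "t \<in> {0..1}" "s \<in> {0..1}" for t s
        using H_nonneg[OF that] H_le_majorant[OF hyps that] a by simp
      show "(\<lambda>s. a * ?\<Phi> s) integrable_on {0..1}"
        by (intro integrable_continuous_real continuous_on_mult_left cont_\<Phi>)
    qed
    also have "\<dots> = a * \<tau>2 \<alpha> \<eta> \<mu> \<beta> A"
      using integral_majorant[OF hyps BV] by simp
    finally show ?thesis .
  qed
  have linear: "bounded_linear (kernel_op ?k)" by (rule bounded_linear_kernel_op[OF cont_k])
  show ?thesis
    unfolding Ka_op using K_op linear gelfand_convergent[OF linear] lower upper by blast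
qed

end
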